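(* Let $K$ be a field of characteristic $p\neq 2$. (1) For every assosymmetric algebra $A=(A,\cdot)$ over $K$, the plus-algebra $A^{(+)}=(A,\star)$ is a Lie triple algebra, i.e. $$\langle a,b\star b,c\rangle = 2\, b\star\langle a,b,c\rangle\qquad\text{for all } a,b,c\in A.$$ (2) For every assosymmetric algebra $A$ over $K$, the plus-algebra $A^{(+)}$ satisfies the Glennie identity $$glen(a,b,c)=shest(a,b,c\star c)-2\,c\star shest(a,b,c)=0\qquad\text{for all } a,b,c\in A.$$ (3) The three identities $[t_1,t_2]=0$, $lietriple(t_1,t_2,t_3)=0$ and $glen(t_1,t_2,t_3)=0$ are independent.
   Context: Algebras are vector spaces over $K$ with a bilinear, not necessarily associative, multiplication $\cdot$ (often written as juxtaposition). For an algebra $A=(A,\cdot)$ write $(a,b,c)=a\cdot(b\cdot c)-(a\cdot b)\cdot c$, $[a,b]=a\cdot b-b\cdot a$, $a\star b=a\cdot b+b\cdot a$, $\langle a,b,c\rangle=a\star(b\star c)-(a\star b)\star c$, and $b^2=b\cdot b$. The plus-algebra is $A^{(+)}=(A,\star)$. $A$ is assosymmetric if $(a,b,c)=(b,a,c)$ and $(a,b,c)=(a,c,b)$ for all $a,b,c\in A$. Put $lietriple(t_1,t_2,t_3)=(t_1,t_2^2,t_3)-t_2\star(t_1,t_2,t_3)$. A Lie triple algebra is a commutative algebra satisfying $lietriple=0$, i.e. (for a commutative algebra) $(a,b^2,c)=2b(a,b,c)$ for all $a,b,c$. Put $$shest(t_1,t_2,t_3)=-3\langle t_1,t_3,t_2\rangle\star\bigl(\langle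 t_1,t_1,t_2^2\rangle-\langle t_1,t_1,t_2\rangle\star t_2\bigr)-2\langle t_1,\langle t_1,\langle t_1,t_3,t_2\rangle,t_2\rangle,t_2\rangle,$$ $$glen(t_1,t_2,t_3)=shest(t_1,t_2,t_3\star t_3)-2\,t_3\star shest(t_1,t_2,t_3).$$ These are elements of the free (magmatic) non-associative, non-commutative algebra $K\langle t_1,t_2,t_3\rangle$ and can be evaluated on elements of any algebra $(A,\cdot)$ (with $x\star y=x\cdot y+y\cdot x$, $\langle x,y,z\rangle=x\star(y\star z)-(x\star y)\star z$ and $t_2^2=t_2\cdot t_2=\tfrac12 t_2\star t_2$ formed from the multiplication $\cdot$). An algebra satisfies the identity $f=0$ if $f$ vanishes under all substitutions of elements of the algebra for the variables. An identity is a consequence of a set of identities if every $K$-algebra satisfying the identities in the set also satisfies it. Identities are independent if none of them is a consequence of the others.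
   Formalization: In (3), full independence is proved only for p ≠ 3: for p = 3, glen = 0 follows from [t1,t2] = 0 and lietriple = 0. That [t1,t2] = 0 and lietriple = 0 are each not a consequence of the other two identities is proved for all p ≠ 2. *)

theory Defs
  imports Complex_Main "HOL-Library.Poly_Mapping"
begin

text \<open>
  An algebra is a vector space with a bilinear multiplication; no associativity, commutativity or
  unit is assumed. The operations below take the multiplication as an argument, so that they apply
  to \<open>A\<close>, to the plus-algebra of \<open>A\<close> (multiplication \<open>star mul\<close>) and to the free algebra.
\<close>

locale nonassoc_algebra = vector_space scale
  for scale :: "'k::field \<Rightarrow> 'a::ab_group_add \<Rightarrow> 'a" +
  fixes mul :: "'a \<Rightarrow> 'a \<Rightarrow> 'a"
  assumes linear_right: "Vector_Spaces.linear scale scale (\<lambda>y. mul x y)"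
    and linear_left: "Vector_Spaces.linear scale scale (\<lambda>x. mul x y)"

definition associator :: "('a::ab_group_add \<Rightarrow> 'a \<Rightarrow> 'a) \<Rightarrow> 'a \<Rightarrow> 'a \<Rightarrow> 'a \<Rightarrow> 'a" where
  "associator mul a b c = mul a (mul b c) - mul (mul a b) c"

definition commutator :: "('a::ab_group_add \<Rightarrow> 'a \<Rightarrow> 'a) \<Rightarrow> 'a \<Rightarrow> 'a \<Rightarrow> 'a" where
  "commutator mul a b = mul a b - mul b a"

definition star :: "('a::ab_group_add \<Rightarrow> 'a \<Rightarrow> 'a) \<Rightarrow> 'a \<Rightarrow> 'a \<Rightarrow> 'a" where
  "star mul a b = mul a b + mul b a"

text \<open>The bracket \<open>\<langle>a,b,c\<rangle> = a \<star> (b \<star> c) - (a \<star> b) \<star> c\<close>.\<close>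

definition jassoc :: "('a::ab_group_add \<Rightarrow> 'a \<Rightarrow> 'a) \<Rightarrow> 'a \<Rightarrow> 'a \<Rightarrow> 'a \<Rightarrow> 'a" where
  "jassoc mul = associator (star mul)"

locale assosymmetric_algebra = nonassoc_algebra +
  assumes left_symmetric: "associator mul a b c = associator mul b a c"
    and right_symmetric: "associator mul a b c = associator mul a c b"

definition lietriple :: "('a::ab_group_add \<Rightarrow> 'a \<Rightarrow> 'a) \<Rightarrow> 'a \<Rightarrow> 'a \<Rightarrow> 'a \<Rightarrow> 'a" where
  "lietriple mul t1 t2 t3 =
     associator mul t1 (mul t2 t2) t3 - star mul t2 (associator mul t1 t2 t3)"

definition shest ::
  "('k::field \<Rightarrow> 'a::ab_group_add \<Rightarrow> 'a) \<Rightarrow> ('a \<Rightarrow> 'a \<Rightarrow> 'a) \<Rightarrow> 'a \<Rightarrow> 'a \<Rightarrow> 'a \<Rightarrow> 'a" where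
  "shest scale mul t1 t2 t3 =
     scale (- 3) (star mul (jassoc mul t1 t3 t2)
       (jassoc mul t1 t1 (mul t2 t2) - star mul (jassoc mul t1 t1 t2) t2))
     - scale 2 (jassoc mul t1 (jassoc mul t1 (jassoc mul t1 t3 t2) t2) t2)"

definition glen ::
  "('k::field \<Rightarrow> 'a::ab_group_add \<Rightarrow> 'a) \<Rightarrow> ('a \<Rightarrow> 'a \<Rightarrow> 'a) \<Rightarrow> 'a \<Rightarrow> 'a \<Rightarrow> 'a \<Rightarrow> 'a" where
  "glen scale mul t1 t2 t3 =
     shest scale mul t1 t2 (star mul t3 t3) - scale 2 (star mul t3 (shest scale mul t1 t2 t3))"


text \<open>
  The free non-associative, non-commutative algebra \<open>K\<langle>t\<^sub>1,t\<^sub>2,t\<^sub>3\<rangle>\<close>: finitely supported functions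
  on the free magma on three generators.
\<close>

datatype indet = T1 | T2 | T3

datatype monomial = Indet indet | Times monomial monomial

type_synonym 'k free_alg = "monomial \<Rightarrow>\<^sub>0 'k"

definition free_scale :: "'k::field \<Rightarrow> 'k free_alg \<Rightarrow> 'k free_alg" where
  "free_scale c = Poly_Mapping.map ((*) c)"

definition free_mul :: "'k::field free_alg \<Rightarrow> 'k free_alg \<Rightarrow> 'k free_alg" where
  "free_mul f g = (\<Sum>m\<in>Poly_Mapping.keys f. \<Sum>n\<in>Poly_Mapping.keys g.
     Poly_Mapping.single (Times m n) (Poly_Mapping.lookup f m * Poly_Mapping.lookup g n))"

definition gen :: "indet \<Rightarrow> 'k::field free_alg" where
  "gen i = Poly_Mapping.single (Indet i) 1"

primrec eval_monomial :: "('a \<Rightarrow> 'a \<Rightarrow> 'a) \<Rightarrow> (indet \<Rightarrow> 'a) \<Rightarrow> monomial \<Rightarrow> 'a" where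
  "eval_monomial mul \<rho> (Indet i) = \<rho> i"
| "eval_monomial mul \<rho> (Times m n) = mul (eval_monomial mul \<rho> m) (eval_monomial mul \<rho> n)"

definition eval_free ::
  "('k::field \<Rightarrow> 'a::ab_group_add \<Rightarrow> 'a) \<Rightarrow> ('a \<Rightarrow> 'a \<Rightarrow> 'a) \<Rightarrow> (indet \<Rightarrow> 'a) \<Rightarrow> 'k free_alg \<Rightarrow> 'a"
  where
  "eval_free scale mul \<rho> f =
    (\<Sum>m\<in>Poly_Mapping.keys f. scale (Poly_Mapping.lookup f m) (eval_monomial mul \<rho> m))"

definition satisfies ::
  "('k::field \<Rightarrow> 'a::ab_group_add \<Rightarrow> 'a) \<Rightarrow> ('a \<Rightarrow> 'a \<Rightarrow> 'a) \<Rightarrow> 'k free_alg \<Rightarrow> bool" where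
  "satisfies scale mul f \<longleftrightarrow> (\<forall>\<rho>. eval_free scale mul \<rho> f = 0)"

definition comm_id :: "'k::field free_alg" where
  "comm_id = commutator free_mul (gen T1) (gen T2)"

definition lietriple_id :: "'k::field free_alg" where
  "lietriple_id = lietriple free_mul (gen T1) (gen T2) (gen T3)"

definition glen_id :: "'k::field free_alg" where
  "glen_id = glen free_scale free_mul (gen T1) (gen T2) (gen T3)"

definition lie_triple_algebra ::
  "('k::field \<Rightarrow> 'a::ab_group_add \<Rightarrow> 'a) \<Rightarrow> ('a \<Rightarrow> 'a \<Rightarrow> 'a) \<Rightarrow> bool" where
  "lie_triple_algebra scale mul \<longleftrightarrow> nonassoc_algebra scale mul \<and>
     satisfies scale mul comm_id \<and> satisfies scale mul lietriple_id"

text \<open>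
  HOL cannot quantify over all types inside a formula, so ``every \<open>K\<close>-algebra'' ranges over all
  algebra structures on the type of finitely supported sequences over \<open>K\<close>. Nothing is lost: an
  identity that fails in some algebra fails in a finitely generated subalgebra \<open>B \<noteq> 0\<close>, of at most
  countable dimension, and the countable direct sum of copies of \<open>B\<close>, whose underlying space is
  isomorphic to that of finitely supported sequences, satisfies exactly the same identities as \<open>B\<close>.
  For negative statements (non-consequence, independence) the restriction to one underlying type
  can only make the assertion stronger.
\<close>

definition is_consequence :: "'k::field free_alg \<Rightarrow> 'k free_alg set \<Rightarrow> bool" where
  "is_consequence f G \<longleftrightarrow>
     (\<forall>(scale :: 'k \<Rightarrow> (nat \<Rightarrow>\<^sub>0 'k) \<Rightarrow> (nat \<Rightarrow>\<^sub>0 'k)) mul.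
        nonassoc_algebra scale mul \<longrightarrow> (\<forall>g\<in>G. satisfies scale mul g) \<longrightarrow> satisfies scale mul f)"

definition independent_identities :: "'k::field free_alg set \<Rightarrow> bool" where
  "independent_identities G \<longleftrightarrow> (\<forall>f\<in>G. \<not> is_consequence f (G - {f}))"


text \<open>Evaluation is an algebra homomorphism, so the identities mean what they say.\<close>

context nonassoc_algebra
begin

lemmas mul_add_right = Vector_Spaces.linear.axioms(3)[OF linear_right, THEN module_hom.add]
lemmas mul_add_left = Vector_Spaces.linear.axioms(3)[OF linear_left, THEN module_hom.add]
lemmas mul_scale_right = Vector_Spaces.linear.axioms(3)[OF linear_right, THEN module_hom.scale]
lemmas mul_scale_left = Vector_Spaces.linear.axioms(3)[OF linear_left, THEN module_hom.scale]
lemmas mul_diff_right = Vector_Spaces.linear.axioms(3)[OF linear_right, THEN module_hom.diff]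
lemmas mul_diff_left = Vector_Spaces.linear.axioms(3)[OF linear_left, THEN module_hom.diff]
lemmas mul_sum_right = Vector_Spaces.linear.axioms(3)[OF linear_right, THEN module_hom.sum]
lemmas mul_sum_left = Vector_Spaces.linear.axioms(3)[OF linear_left, THEN module_hom.sum]

lemma eval_free_superset:
  assumes "finite S" "Poly_Mapping.keys f \<subseteq> S"
  shows "eval_free scale mul \<rho> f =
    (\<Sum>m\<in>S. scale (Poly_Mapping.lookup f m) (eval_monomial mul \<rho> m))"
  unfolding eval_free_def
  by (rule sum.mono_neutral_left) (use assms in \<open>auto simp: in_keys_iff\<close>)

lemma eval_free_add:
  "eval_free scale mul \<rho> (f + g) = eval_free scale mul \<rho> f + eval_free scale mul \<rho> g"
proof -
  let ?S = "Poly_Mapping.keys f \<union> Poly_Mapping.keys g"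
  have "Poly_Mapping.keys (f + g) \<subseteq> ?S" by (rule Poly_Mapping.keys_add)
  then show ?thesis
    by (simp add: eval_free_superset[of ?S] lookup_add scale_left_distrib sum.distrib)
qed

lemma eval_free_zero: "eval_free scale mul \<rho> 0 = 0"
  by (simp add: eval_free_def)

lemma eval_free_diff:
  "eval_free scale mul \<rho> (f - g) = eval_free scale mul \<rho> f - eval_free scale mul \<rho> g"
  using eval_free_add[of \<rho> "f - g" g] by (simp add: algebra_simps)

lemma eval_free_sum:
  "eval_free scale mul \<rho> (\<Sum>i\<in>I. F i) = (\<Sum>i\<in>I. eval_free scale mul \<rho> (F i))"
  by (induction I rule: infinite_finite_induct) (simp_all add: eval_free_zero eval_free_add)

lemma eval_free_single:
  "eval_free scale mul \<rho> (Poly_Mapping.single m c) = scale c (eval_monomial mul \<rho> m)"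
  by (cases "c = 0") (simp_all add: eval_free_def)

lemma eval_free_gen: "eval_free scale mul \<rho> (gen i) = \<rho> i"
  by (simp add: gen_def eval_free_single)

lemma eval_free_scale:
  "eval_free scale mul \<rho> (free_scale c f) = scale c (eval_free scale mul \<rho> f)"
proof -
  have l: "Poly_Mapping.lookup (free_scale c f) m = c * Poly_Mapping.lookup f m" for m
    by (simp add: free_scale_def Poly_Mapping.map.rep_eq when_def)
  have "Poly_Mapping.keys (free_scale c f) \<subseteq> Poly_Mapping.keys f"
    by (auto simp: in_keys_iff l)
  then show ?thesis
    by (simp add: eval_free_superset[of "Poly_Mapping.keys f"] l scale_sum_right)
qed

lemma eval_free_mul:
  "eval_free scale mul \<rho> (free_mul f g) =
     mul (eval_free scale mul \<rho> f) (eval_free scale mul \<rho> g)"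
proof -
  let ?l = Poly_Mapping.lookup and ?e = "eval_monomial mul \<rho>"
  have "mul (eval_free scale mul \<rho> f) (eval_free scale mul \<rho> g)
      = (\<Sum>m\<in>Poly_Mapping.keys f. \<Sum>n\<in>Poly_Mapping.keys g.
          mul (scale (?l f m) (?e m)) (scale (?l g n) (?e n)))"
    unfolding eval_free_def mul_sum_left unfolding mul_sum_right ..
  then show ?thesis
    by (simp add: free_mul_def eval_free_sum eval_free_single mul_scale_left mul_scale_right
        mult.commute)
qed

lemmas eval_free_simps =
  eval_free_add eval_free_diff eval_free_scale eval_free_mul eval_free_gen

lemma satisfies_comm_id: "satisfies scale mul comm_id \<longleftrightarrow> (\<forall>a b. commutator mul a b = 0)"
proof -
  have *: "eval_free scale mul \<rho> comm_id = commutator mul (\<rho> T1) (\<rho> T2)" for \<rho>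
    by (simp add: comm_id_def commutator_def eval_free_simps)
  have "commutator mul a b = 0" if "satisfies scale mul comm_id" for a b
    using that[unfolded satisfies_def, rule_format, of "case_indet a b undefined"]
    by (simp add: *)
  then show ?thesis by (auto simp: satisfies_def *)
qed

lemma satisfies_lietriple_id:
  "satisfies scale mul lietriple_id \<longleftrightarrow> (\<forall>a b c. lietriple mul a b c = 0)"
proof -
  have *: "eval_free scale mul \<rho> lietriple_id = lietriple mul (\<rho> T1) (\<rho> T2) (\<rho> T3)" for \<rho>
    by (simp add: lietriple_id_def lietriple_def associator_def star_def eval_free_simps)
  have "lietriple mul a b c = 0" if "satisfies scale mul lietriple_id" for a b c
    using that[unfolded satisfies_def, rule_format, of "case_indet a b c"]
    by (simp add: *)
  then show ?thesis by (auto simp: satisfies_def *)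
qed

lemma satisfies_glen_id:
  "satisfies scale mul glen_id \<longleftrightarrow> (\<forall>a b c. glen scale mul a b c = 0)"
proof -
  have *: "eval_free scale mul \<rho> glen_id = glen scale mul (\<rho> T1) (\<rho> T2) (\<rho> T3)" for \<rho>
    by (simp add: glen_id_def glen_def shest_def jassoc_def associator_def star_def
        eval_free_simps)
  have "glen scale mul a b c = 0" if "satisfies scale mul glen_id" for a b c
    using that[unfolded satisfies_def, rule_format, of "case_indet a b c"]
    by (simp add: *)
  then show ?thesis by (auto simp: satisfies_def *)
qed

text \<open>
  In characteristic 3 the first term of \<open>shest\<close> vanishes and the second is the cube of a derivation
  of the plus-algebra, hence again a derivation. So every Lie triple algebra satisfies the Glennie
  identity there, and the three identities are not independent: independence of \<open>glen\<close> from the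
  other two needs characteristic \<open>\<noteq> 3\<close>.
\<close>

lemma lie_triple_glen_char_3:
  assumes "CHAR('k) = 3" and "satisfies scale mul comm_id" and "satisfies scale mul lietriple_id"
  shows "satisfies scale mul glen_id"
proof -
  have comm: "mul x y = mul y x" for x y
    using assms(2) by (simp add: satisfies_comm_id commutator_def)
  have lt: "associator mul a (mul b b) c = star mul b (associator mul a b c)" for a b c
    using assms(3) by (simp add: satisfies_lietriple_id lietriple_def)
  have three: "(3::'k) = 0"
    using of_nat_CHAR[where 'a = 'k] assms(1) by simp
  have three_x: "x + x + x = 0" for x :: 'a
  proof -
    have "x + x + x = scale (1 + 1 + 1) x"
      by (simp only: scale_left_distrib scale_one)
    also have "(1 + 1 + 1 :: 'k) = 3" by simp
    finally show ?thesis by (simp add: three)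
  qed
  have assoc_add: "associator mul a (x + y) c = associator mul a x c + associator mul a y c"
    for a x y c
    by (simp add: associator_def mul_add_left mul_add_right algebra_simps)
  have star_add: "star mul (x + y) z = star mul x z + star mul y z"
    "star mul z (x + y) = star mul z x + star mul z y"
    "star mul (x - y) z = star mul x z - star mul y z"
    "star mul z (x - y) = star mul z x - star mul z y" for x y z
    by (simp_all add: star_def mul_add_left mul_add_right mul_diff_left mul_diff_right algebra_simps)
  have star_scale: "star mul z (scale r x) = scale r (star mul z x)" for r x z
    by (simp add: star_def mul_scale_left mul_scale_right scale_right_distrib)
  have star_comm: "star mul x y = star mul y x" for x y
    by (simp add: star_def add.commute)
  have der0: "associator mul a (star mul x y) c
      = star mul x (associator mul a y c) + star mul y (associator mul a x c)" for a x y c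
    using lt[of a "x + y" c] lt[of a x c] lt[of a y c]
    by (simp add: mul_add_left mul_add_right assoc_add star_add star_def[of _ x y] algebra_simps)
  have star_double: "star mul x y = mul x y + mul x y" for x y
    using comm[of y x] by (simp add: star_def)
  have J: "jassoc mul a x c = associator mul a x c + associator mul a x c
      + (associator mul a x c + associator mul a x c)" for a x c
    by (simp add: jassoc_def associator_def star_double mul_add_left mul_add_right algebra_simps)
  have main: "glen scale mul a b c = 0" for a b c
  proof -
    define D where "D = (\<lambda>x. jassoc mul a x b)"
    have D_add: "D (x + y) = D x + D y" for x y
      by (simp add: D_def J assoc_add algebra_simps)
    have D_star: "D (star mul x y) = star mul (D x) y + star mul x (D y)" for x y
      by (simp add: D_def J der0 star_add star_comm[of _ y] algebra_simps)
    have sh: "shest scale mul a b x = - scale 2 (D (D (D x)))" for x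
      by (simp add: shest_def D_def three)
    have "D (D (D (star mul c c))) = star mul c (D (D (D c))) + star mul c (D (D (D c)))
        + (star mul (D c) (D (D c)) + star mul (D c) (D (D c)) + star mul (D c) (D (D c)))
        + (star mul (D c) (D (D c)) + star mul (D c) (D (D c)) + star mul (D c) (D (D c)))"
      by (simp add: D_star D_add star_comm[of "D (D c)"] star_comm[of "D (D (D c))"] algebra_simps)
    then have D3: "D (D (D (star mul c c))) = star mul c (D (D (D c))) + star mul c (D (D (D c)))"
      by (simp add: three_x)
    have two: "scale 2 x = x + x" for x
      by (metis one_add_one scale_left_distrib scale_one)
    have neg: "star mul c (- x) = - star mul c x" for x
      using star_add(4)[of c 0 x] star_add(4)[of c 0 0] by simp
    show ?thesis
      by (simp add: glen_def sh D3 two neg star_add algebra_simps)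
  qed
  then show ?thesis by (simp add: satisfies_glen_id)
qed

end

lemma glen_is_consequence_char_3:
  assumes "CHAR('k::field) = 3"
  shows "is_consequence (glen_id :: 'k free_alg) {comm_id, lietriple_id}"
  using nonassoc_algebra.lie_triple_glen_char_3[OF _ assms] by (auto simp: is_consequence_def)

end

theory Submission
  imports Defs "HOL-Computational_Algebra.Primes"
begin

text \<open>
  In an assosymmetric algebra the associator \<open>(a, b, c)\<close> is symmetric, so the associator of the
  plus-algebra becomes a double commutator: \<open>\<langle>a, b, c\<rangle> = [[a, c], b]\<close>
  (\<open>jassoc_eq_double_commutator\<close>). Everything then depends on how commutators and associators
  interact, which the Teichmueller identity decides in characteristic other than 2: the expression
  \<open>[a, (b, c, d)]\<close> is symmetric in all four arguments, and \<open>([a, b], c, d) = 0\<close>. Consequently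
  \<open>D = [w, -]\<close> with \<open>w = [a, b]\<close> is a derivation of the plus-algebra, which is the Lie triple
  identity, and \<open>w\<close> commutes with every associator.

  For the Glennie identity let \<open>u\<close> be the factor \<open>\<langle>a, a, b\<^sup>2\<rangle> - \<langle>a, a, b\<rangle> \<star> b\<close> in \<open>shest\<close>. By the
  Leibniz rule \<open>glen(a, b, c) = 6 \<langle>c, D c, u\<rangle> - 12 (D c \<star> D\<^sup>2 c)\<close>, and
  \<open>u = - 2 w\<^sup>2 - [a, (a, b, b)]\<close>. The correction term does not contribute to \<open>\<langle>c, D c, u\<rangle>\<close> because
  of the commutation rules above, and \<open>- 2 w\<^sup>2\<close> contributes \<open>2 (D c \<star> D\<^sup>2 c)\<close>, as it would
  in an associative algebra.

  Independence is shown by three finite-dimensional algebras. For commutativity and for the Lie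
  triple identity small nilpotent algebras suffice, because \<open>glen\<close> is homogeneous of degree eight.
  The algebra that violates only the Glennie identity is a Jordan algebra. It has to be exceptional,
  since special Jordan algebras satisfy the identity; a subalgebra of dimension 15 of the split
  Albert algebra is large enough, and in it \<open>glen\<close> takes the value \<open>2\<^sup>1\<^sup>1 \<cdot> 3\<close> times a basis vector.
\<close>

section \<open>Algebras and their plus-algebras\<close>

lemma of_nat_prime_neq_0:
  assumes "prime p" and "CHAR('k::field) \<noteq> p"
  shows "(of_nat p :: 'k) \<noteq> 0"
  using assms CHAR_not_1[where 'a = 'k] by (auto simp: of_nat_eq_0_iff_char_dvd prime_nat_iff)

context nonassoc_algebra
begin

lemma scale_two: "scale 2 x = x + x"
  by (metis one_add_one scale_left_distrib scale_one)

lemma nonassoc_algebra_star: "nonassoc_algebra scale (star mul)"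
proof
  fix x y z :: 'a and r
  show "star mul x (y + z) = star mul x y + star mul x z"
    "star mul (x + y) z = star mul x z + star mul y z"
    "star mul x (scale r y) = scale r (star mul x y)"
    "star mul (scale r x) y = scale r (star mul x y)"
    by (simp_all add: star_def mul_add_left mul_add_right mul_scale_left mul_scale_right
        scale_right_distrib algebra_simps)
qed

text \<open>
  Forming the plus-algebra twice multiplies the product by 2. Both terms of \<open>glen\<close> contain seven
  multiplications, so all the powers of 2 combine to one factor, and the identity for the
  plus-algebra says the same as the expression formed from the original product.
\<close>

lemma glen_star: "glen scale (star mul) a b c = scale 128 (glen scale mul a b c)"
proof -
  interpret plus: nonassoc_algebra scale "star mul" by (rule nonassoc_algebra_star)
  have star: "star (star mul) x y = scale 2 (star mul x y)" for x y
    by (simp add: star_def scale_two algebra_simps)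
  have square: "star mul x x = scale 2 (mul x x)" for x
    by (simp add: star_def scale_two)
  have jassoc: "jassoc (star mul) x y z = scale 4 (jassoc mul x y z)" for x y z
    by (simp add: jassoc_def associator_def star plus.mul_scale_left plus.mul_scale_right
        scale_right_diff_distrib)
  have jassoc_scale: "jassoc mul (scale r x) y z = scale r (jassoc mul x y z)"
    "jassoc mul x (scale r y) z = scale r (jassoc mul x y z)"
    "jassoc mul x y (scale r z) = scale r (jassoc mul x y z)" for r x y z
    by (simp_all add: jassoc_def associator_def plus.mul_scale_left plus.mul_scale_right
        scale_right_diff_distrib)
  have shest: "shest scale (star mul) a b x = scale 64 (shest scale mul a b x)" for x
  proof -
    have "jassoc (star mul) a a (star mul b b) - star (star mul) (jassoc (star mul) a a b) b
        = scale 8 (jassoc mul a a (mul b b) - star mul (jassoc mul a a b) b)"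
      by (simp add: jassoc jassoc_scale star square[of b] plus.mul_scale_left scale_right_diff_distrib)
    then show ?thesis
      unfolding shest_def
      \<comment> \<open>The equation is substituted first, since distributing \<open>star\<close> would break up its left side.\<close>
      by (simp only:) (simp add: jassoc jassoc_scale star plus.mul_diff_right plus.mul_scale_left
          plus.mul_scale_right scale_right_diff_distrib)
  qed
  have shest_scale: "shest scale mul a b (scale r x) = scale r (shest scale mul a b x)" for r x
    unfolding shest_def
    by (simp add: jassoc_scale plus.mul_scale_left scale_right_diff_distrib mult.commute)
  show ?thesis
    by (simp add: glen_def shest shest_scale star plus.mul_scale_right scale_right_diff_distrib)
qed

end


section \<open>Assosymmetric algebras\<close>

locale assosymmetric_algebra_not_char_2 = assosymmetric_algebra scale mul
  for scale :: "'k::field \<Rightarrow> 'a::ab_group_add \<Rightarrow> 'a" and mul :: "'a \<Rightarrow> 'a \<Rightarrow> 'a" +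
  assumes char_not_2: "CHAR('k) \<noteq> 2"
begin

notation mul (infixl "\<cdot>" 70)

abbreviation jordan (infixl "\<star>" 70) where "x \<star> y \<equiv> star (\<cdot>) x y"
abbreviation lie ("\<lbrakk>_, _\<rbrakk>") where "\<lbrakk>x, y\<rbrakk> \<equiv> commutator (\<cdot>) x y"
abbreviation assoc ("\<lparr>_, _, _\<rparr>") where "\<lparr>x, y, z\<rparr> \<equiv> associator (\<cdot>) x y z"

lemmas bilinear_simps =
  mul_add_right mul_add_left mul_diff_right mul_diff_left mul_scale_right mul_scale_left

lemma mul_minus: "(- x) \<cdot> y = - (x \<cdot> y)" "x \<cdot> (- y) = - (x \<cdot> y)"
  using mul_diff_left[of 0 x y] mul_diff_left[of 0 0 y] mul_diff_right[of x 0 y]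
    mul_diff_right[of x 0 0] by simp_all

lemma commutator_bilinear:
  "\<lbrakk>x + y, z\<rbrakk> = \<lbrakk>x, z\<rbrakk> + \<lbrakk>y, z\<rbrakk>" "\<lbrakk>z, x + y\<rbrakk> = \<lbrakk>z, x\<rbrakk> + \<lbrakk>z, y\<rbrakk>"
  "\<lbrakk>x - y, z\<rbrakk> = \<lbrakk>x, z\<rbrakk> - \<lbrakk>y, z\<rbrakk>" "\<lbrakk>z, x - y\<rbrakk> = \<lbrakk>z, x\<rbrakk> - \<lbrakk>z, y\<rbrakk>"
  "\<lbrakk>- x, z\<rbrakk> = - \<lbrakk>x, z\<rbrakk>" "\<lbrakk>z, - x\<rbrakk> = - \<lbrakk>z, x\<rbrakk>"
  "\<lbrakk>scale k x, z\<rbrakk> = scale k \<lbrakk>x, z\<rbrakk>" "\<lbrakk>z, scale k x\<rbrakk> = scale k \<lbrakk>z, x\<rbrakk>"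
  by (simp_all add: commutator_def bilinear_simps mul_minus scale_right_diff_distrib algebra_simps)

lemma commutator_zero: "\<lbrakk>x, 0\<rbrakk> = 0" "\<lbrakk>0, x\<rbrakk> = 0"
  using commutator_bilinear(1)[of 0 0 x] commutator_bilinear(2)[of x 0 0] by simp_all

lemma commutator_antisym: "\<lbrakk>x, y\<rbrakk> = - \<lbrakk>y, x\<rbrakk>"
  by (simp add: commutator_def)

lemma star_bilinear:
  "(x + y) \<star> z = x \<star> z + y \<star> z" "z \<star> (x + y) = z \<star> x + z \<star> y"
  "(x - y) \<star> z = x \<star> z - y \<star> z" "z \<star> (x - y) = z \<star> x - z \<star> y"
  "(- x) \<star> z = - (x \<star> z)" "z \<star> (- x) = - (z \<star> x)"
  "scale k x \<star> z = scale k (x \<star> z)" "z \<star> scale k x = scale k (z \<star> x)"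
  by (simp_all add: star_def bilinear_simps mul_minus scale_right_distrib algebra_simps)

lemma star_commute: "x \<star> y = y \<star> x"
  by (simp add: star_def add.commute)

lemma double_eq_imp:
  assumes "x + x = y + (y :: 'a)"
  shows "x = y"
proof -
  have "scale 2 (x - y) = 0"
    using assms by (simp add: scale_two algebra_simps)
  moreover have "(2::'k) \<noteq> 0"
    using of_nat_prime_neq_0[of 2] char_not_2 by simp
  ultimately show ?thesis by simp
qed

text \<open>
  As a rewrite rule this moves all products of three factors into left-bracketed form, up to
  associators, which the two symmetry laws then bring into a normal form.
\<close>

lemma reassociate: "x \<cdot> (y \<cdot> z) = \<lparr>x, y, z\<rparr> + x \<cdot> y \<cdot> z"
  by (simp add: associator_def)

text \<open>
  The six permutations of an associator that occur on the left cancel in pairs because associators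
  are symmetric. This is the fact that turns Jordan brackets into Lie brackets.
\<close>

lemma jassoc_eq_double_commutator: "jassoc (\<cdot>) x y z = \<lbrakk>\<lbrakk>x, z\<rbrakk>, y\<rbrakk>"
  by (simp add: jassoc_def associator_def[of "star (\<cdot>)"] star_def commutator_def bilinear_simps reassociate
      left_symmetric right_symmetric algebra_simps)

lemma jacobi: "\<lbrakk>x, \<lbrakk>y, z\<rbrakk>\<rbrakk> = \<lbrakk>\<lbrakk>x, y\<rbrakk>, z\<rbrakk> + \<lbrakk>y, \<lbrakk>x, z\<rbrakk>\<rbrakk>"
  by (simp add: commutator_def bilinear_simps reassociate
      left_symmetric right_symmetric algebra_simps)

lemma commutator_mul: "\<lbrakk>w, x \<cdot> y\<rbrakk> = \<lbrakk>w, x\<rbrakk> \<cdot> y + x \<cdot> \<lbrakk>w, y\<rbrakk> + \<lparr>w, x, y\<rparr>"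
  by (simp add: commutator_def bilinear_simps reassociate
      left_symmetric right_symmetric algebra_simps)

text \<open>
  The Teichmueller identity holds in every algebra; by symmetry each of its associators can be
  written with the product in the first place.
\<close>

lemma teichmueller:
  "\<lparr>a \<cdot> b, c, d\<rparr> - \<lparr>b \<cdot> c, a, d\<rparr> + \<lparr>c \<cdot> d, a, b\<rparr> = a \<cdot> \<lparr>b, c, d\<rparr> + \<lparr>a, b, c\<rparr> \<cdot> d"
proof -
  have "\<lparr>a \<cdot> b, c, d\<rparr> - \<lparr>a, b \<cdot> c, d\<rparr> + \<lparr>a, b, c \<cdot> d\<rparr> = a \<cdot> \<lparr>b, c, d\<rparr> + \<lparr>a, b, c\<rparr> \<cdot> d"
    by (simp add: associator_def bilinear_simps algebra_simps)
  moreover have "\<lparr>a, b \<cdot> c, d\<rparr> = \<lparr>b \<cdot> c, a, d\<rparr>" "\<lparr>a, b, c \<cdot> d\<rparr> = \<lparr>c \<cdot> d, a, b\<rparr>"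
    by (metis left_symmetric right_symmetric)+
  ultimately show ?thesis by simp
qed

text \<open>Adding two cyclic shifts of the Teichmueller identity leaves only two associators of products.\<close>

lemma associator_mul_cyclic:
  "\<lparr>x \<cdot> y, u, z\<rparr> + \<lparr>z \<cdot> x, y, u\<rparr>
     = x \<cdot> \<lparr>y, u, z\<rparr> + \<lparr>y, u, z\<rparr> \<cdot> x + y \<cdot> \<lparr>x, u, z\<rparr> + \<lparr>x, y, u\<rparr> \<cdot> z"
  using arg_cong2[of _ _ _ _ "(+)", OF teichmueller[of x y u z] teichmueller[of y u z x]]
  by (simp add: left_symmetric right_symmetric algebra_simps)

text \<open>
  The previous identity relates \<open>(a b, c, d)\<close> to \<open>(c a, b, d)\<close>, that to \<open>(b c, a, d)\<close>, and this
  again to \<open>(a b, c, d)\<close>. The cycle has odd length, so the alternating sum of the three relations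
  leaves \<open>2 (a b, c, d)\<close>, and 2 can be cancelled.
\<close>

lemma associator_mul: "\<lparr>a \<cdot> b, c, d\<rparr> = \<lparr>b, c, d\<rparr> \<cdot> a + b \<cdot> \<lparr>a, c, d\<rparr>"
proof (rule double_eq_imp)
  let ?f = "\<lparr>a \<cdot> b, c, d\<rparr>" and ?g = "\<lparr>b, c, d\<rparr> \<cdot> a + b \<cdot> \<lparr>a, c, d\<rparr>"
  show "?f + ?f = ?g + ?g"
    using arg_cong2[of _ _ _ _ "(+)", OF associator_mul_cyclic[of b c d a]
        arg_cong2[of _ _ _ _ "(-)", OF associator_mul_cyclic[of a b d c] associator_mul_cyclic[of c a d b]]]
    by (simp add: left_symmetric right_symmetric algebra_simps)
qed

text \<open>
  Substituting \<open>associator_mul\<close> back into the Teichmueller identity leaves a relation among the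
  four commutators of one argument with the associator of the other three; adding the same
  relation with \<open>c\<close> and \<open>d\<close> exchanged cancels two of them.
\<close>

lemma commutator_associator_symmetric: "\<lbrakk>a, \<lparr>b, c, d\<rparr>\<rbrakk> = \<lbrakk>b, \<lparr>a, c, d\<rparr>\<rbrakk>"
proof -
  have relation: "\<lbrakk>a, \<lparr>b, c, d\<rparr>\<rbrakk> + \<lbrakk>c, \<lparr>a, b, d\<rparr>\<rbrakk> = \<lbrakk>b, \<lparr>a, c, d\<rparr>\<rbrakk> + \<lbrakk>d, \<lparr>a, b, c\<rparr>\<rbrakk>" for a b c d
    using teichmueller[of a b c d, unfolded associator_mul]
    by (simp add: commutator_def left_symmetric right_symmetric algebra_simps)
  show ?thesis
    by (rule double_eq_imp)
      (use arg_cong2[of _ _ _ _ "(+)", OF relation[of a b c d] relation[of a b d c]] in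
        \<open>simp add: left_symmetric right_symmetric algebra_simps\<close>)
qed

lemma associator_commutator: "\<lparr>\<lbrakk>a, b\<rbrakk>, c, d\<rparr> = 0"
proof -
  have "\<lparr>\<lbrakk>a, b\<rbrakk>, c, d\<rparr> = \<lparr>a \<cdot> b, c, d\<rparr> - \<lparr>b \<cdot> a, c, d\<rparr>"
    by (simp add: commutator_def associator_def bilinear_simps algebra_simps)
  also have "\<dots> = \<lbrakk>b, \<lparr>a, c, d\<rparr>\<rbrakk> - \<lbrakk>a, \<lparr>b, c, d\<rparr>\<rbrakk>"
    by (simp add: associator_mul commutator_def algebra_simps)
  finally show ?thesis by (simp add: commutator_associator_symmetric[of b a])
qed

text \<open>
  Hence inner derivations of the Lie algebra by commutators also respect the product \<open>\<star>\<close>: the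
  defect \<open>(w, x, y)\<close> in \<open>commutator_mul\<close> vanishes when \<open>w\<close> is a commutator.
\<close>

lemma double_commutator_star: "\<lbrakk>\<lbrakk>a, b\<rbrakk>, x \<star> y\<rbrakk> = \<lbrakk>\<lbrakk>a, b\<rbrakk>, x\<rbrakk> \<star> y + x \<star> \<lbrakk>\<lbrakk>a, b\<rbrakk>, y\<rbrakk>"
  by (simp add: star_def commutator_bilinear commutator_mul associator_commutator algebra_simps)

lemma jassoc_derivation: "jassoc (\<cdot>) a (b \<star> b) c = scale 2 (b \<star> jassoc (\<cdot>) a b c)"
  by (simp add: jassoc_eq_double_commutator double_commutator_star star_commute scale_two)

text \<open>By symmetry the commutator can be moved into the associator, where it gives zero.\<close>

lemma commutator_commutator_associator: "\<lbrakk>\<lbrakk>a, b\<rbrakk>, \<lparr>x, y, z\<rparr>\<rbrakk> = 0"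
proof -
  have "\<lbrakk>\<lbrakk>a, b\<rbrakk>, \<lparr>x, y, z\<rparr>\<rbrakk> = \<lbrakk>x, \<lparr>\<lbrakk>a, b\<rbrakk>, y, z\<rparr>\<rbrakk>"
    by (rule commutator_associator_symmetric)
  also have "\<dots> = \<lbrakk>x, 0\<rbrakk>" by (simp only: associator_commutator)
  also have "\<dots> = 0" by (rule commutator_zero)
  finally show ?thesis .
qed

text \<open>
  Commutators commute with \<open>(x, y, z)\<close>, hence with \<open>[a, (x, y, z)]\<close> and with its bracket with
  \<open>c\<close>, by the Jacobi identity.
\<close>

lemma commutator_double_commutator_associator:
  "\<lbrakk>\<lbrakk>c, \<lbrakk>a, \<lparr>x, y, z\<rparr>\<rbrakk>\<rbrakk>, \<lbrakk>u, v\<rbrakk>\<rbrakk> = 0"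
proof -
  let ?s = "\<lparr>x, y, z\<rparr>"
  have inner: "\<lbrakk>\<lbrakk>u, v\<rbrakk>, \<lbrakk>a, ?s\<rbrakk>\<rbrakk> = 0" for u v
    by (simp add: jacobi[of "\<lbrakk>u, v\<rbrakk>"] commutator_commutator_associator commutator_zero)
  have "\<lbrakk>\<lbrakk>u, v\<rbrakk>, \<lbrakk>c, \<lbrakk>a, ?s\<rbrakk>\<rbrakk>\<rbrakk> = 0"
    by (simp add: jacobi[of "\<lbrakk>u, v\<rbrakk>" c] inner commutator_zero)
  then show ?thesis
    by (simp add: commutator_antisym[of _ "\<lbrakk>u, v\<rbrakk>"])
qed

text \<open>
  The second factor in the first term of \<open>shest\<close>, in terms of \<open>w = [a, b]\<close>. In an associative
  algebra it is \<open>- 2 w\<^sup>2\<close>; the correction is covered by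
  \<open>commutator_double_commutator_associator\<close>.
\<close>

lemma jassoc_square_defect:
  "jassoc (\<cdot>) a a (b \<cdot> b) - jassoc (\<cdot>) a a b \<star> b
     = - (\<lbrakk>a, b\<rbrakk> \<star> \<lbrakk>a, b\<rbrakk>) - \<lbrakk>a, \<lparr>a, b, b\<rparr>\<rbrakk>"
proof -
  have "\<lbrakk>a, b \<cdot> b\<rbrakk> = \<lbrakk>a, b\<rbrakk> \<star> b + \<lparr>a, b, b\<rparr>"
    by (simp add: commutator_mul star_def)
  then have "jassoc (\<cdot>) a a (b \<cdot> b) = \<lbrakk>\<lbrakk>a, b\<rbrakk> \<star> b, a\<rbrakk> + \<lbrakk>\<lparr>a, b, b\<rparr>, a\<rbrakk>"
    by (simp add: jassoc_eq_double_commutator commutator_bilinear)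
  moreover have "\<lbrakk>\<lbrakk>a, b\<rbrakk> \<star> b, a\<rbrakk> = \<lbrakk>\<lbrakk>a, b\<rbrakk>, a\<rbrakk> \<star> b - \<lbrakk>a, b\<rbrakk> \<star> \<lbrakk>a, b\<rbrakk>"
  proof -
    have 0: "\<lparr>a, \<lbrakk>a, b\<rbrakk>, b\<rparr> = 0" "\<lparr>a, b, \<lbrakk>a, b\<rbrakk>\<rparr> = 0"
      using associator_commutator[of a b] by (metis left_symmetric right_symmetric)+
    have "\<lbrakk>a, \<lbrakk>a, b\<rbrakk> \<star> b\<rbrakk> = \<lbrakk>a, \<lbrakk>a, b\<rbrakk>\<rbrakk> \<star> b + \<lbrakk>a, b\<rbrakk> \<star> \<lbrakk>a, b\<rbrakk>"
      by (simp add: star_def commutator_bilinear commutator_mul 0 algebra_simps)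
    then show ?thesis
      by (simp add: commutator_antisym[of _ a] star_bilinear)
  qed
  ultimately show ?thesis
    by (simp add: jassoc_eq_double_commutator commutator_antisym[of "\<lparr>a, b, b\<rparr>" a])
qed

text \<open>
  Up to the correction term, \<open>[c, u]\<close> is \<open>2 w \<star> [w, c]\<close>. Bracketing this with \<open>[w, c]\<close> is a
  derivation that annihilates the second factor.
\<close>

lemma commutator_square_defect:
  fixes a b c
  defines "w \<equiv> \<lbrakk>a, b\<rbrakk>" and "u \<equiv> jassoc (\<cdot>) a a (b \<cdot> b) - jassoc (\<cdot>) a a b \<star> b"
  shows "jassoc (\<cdot>) c \<lbrakk>w, c\<rbrakk> u = scale 2 (\<lbrakk>w, c\<rbrakk> \<star> \<lbrakk>w, \<lbrakk>w, c\<rbrakk>\<rbrakk>)"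
proof -
  let ?r = "\<lbrakk>a, \<lparr>a, b, b\<rparr>\<rbrakk>"
  have "\<lbrakk>w \<star> w, c\<rbrakk> = scale 2 (w \<star> \<lbrakk>w, c\<rbrakk>)"
  proof -
    have 0: "\<lparr>c, w, w\<rparr> = 0"
      unfolding w_def by (metis associator_commutator left_symmetric)
    have "\<lbrakk>c, w \<star> w\<rbrakk> = scale 2 (w \<star> \<lbrakk>c, w\<rbrakk>)"
      by (simp add: star_def commutator_bilinear commutator_mul 0 scale_two algebra_simps)
    then show ?thesis
      by (simp add: commutator_antisym[of _ c] star_bilinear)
  qed
  then have "\<lbrakk>c, u\<rbrakk> = scale 2 (w \<star> \<lbrakk>w, c\<rbrakk>) - \<lbrakk>c, ?r\<rbrakk>"
    unfolding u_def jassoc_square_defect w_def[symmetric]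
    by (simp add: commutator_bilinear commutator_antisym[of c "w \<star> w"])
  moreover have "\<lbrakk>\<lbrakk>c, ?r\<rbrakk>, \<lbrakk>w, c\<rbrakk>\<rbrakk> = 0"
    by (rule commutator_double_commutator_associator)
  moreover have "\<lbrakk>w \<star> \<lbrakk>w, c\<rbrakk>, \<lbrakk>w, c\<rbrakk>\<rbrakk> = \<lbrakk>w, c\<rbrakk> \<star> \<lbrakk>w, \<lbrakk>w, c\<rbrakk>\<rbrakk>"
  proof -
    have "\<lbrakk>w \<star> \<lbrakk>w, c\<rbrakk>, \<lbrakk>w, c\<rbrakk>\<rbrakk> = - \<lbrakk>\<lbrakk>w, c\<rbrakk>, w \<star> \<lbrakk>w, c\<rbrakk>\<rbrakk>"
      by (rule commutator_antisym)
    also have "\<dots> = - (\<lbrakk>\<lbrakk>w, c\<rbrakk>, w\<rbrakk> \<star> \<lbrakk>w, c\<rbrakk> + w \<star> \<lbrakk>\<lbrakk>w, c\<rbrakk>, \<lbrakk>w, c\<rbrakk>\<rbrakk>)"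
      by (simp only: double_commutator_star)
    also have "\<dots> = \<lbrakk>w, c\<rbrakk> \<star> \<lbrakk>w, \<lbrakk>w, c\<rbrakk>\<rbrakk>"
      using star_bilinear(2)[of w 0 0]
      by (simp add: commutator_antisym[of _ w] star_bilinear star_commute[of "\<lbrakk>w, \<lbrakk>w, c\<rbrakk>\<rbrakk>"])
        (simp add: commutator_def)
    finally show ?thesis .
  qed
  ultimately show ?thesis
    by (simp add: jassoc_eq_double_commutator commutator_bilinear)
qed

text \<open>
  Write \<open>D = [w, -]\<close>. The first term of \<open>shest\<close> fails to be a derivation in \<open>c\<close> by a multiple of
  \<open>\<langle>c, D c, u\<rangle>\<close>, the second, being \<open>D\<^sup>3\<close>, by the middle terms of the Leibniz rule. Both are
  multiples of \<open>D c \<star> D\<^sup>2 c\<close>, and the coefficients \<open>-3\<close> and \<open>-2\<close> are such that they cancel.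
\<close>

lemma glen_eq_0: "glen scale (\<cdot>) a b c = 0"
proof -
  define D where "D = (\<lambda>x. jassoc (\<cdot>) a x b)"
  define u where "u = jassoc (\<cdot>) a a (b \<cdot> b) - jassoc (\<cdot>) a a b \<star> b"
  have D: "D x = \<lbrakk>\<lbrakk>a, b\<rbrakk>, x\<rbrakk>" for x
    by (simp add: D_def jassoc_eq_double_commutator)
  have D_star: "D (x \<star> y) = D x \<star> y + x \<star> D y" and D_add: "D (x + y) = D x + D y" for x y
    by (simp_all add: D double_commutator_star commutator_bilinear)
  have shest: "shest scale (\<cdot>) a b x = scale (- 3) (D x \<star> u) - scale 2 (D (D (D x)))" for x
    by (simp add: shest_def D_def u_def)
  have D3: "D (D (D (c \<star> c))) = scale 2 (c \<star> D (D (D c))) + scale 6 (D c \<star> D (D c))"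
  proof -
    have six: "scale 6 x = x + x + x + x + x + x" for x
    proof -
      have "(6::'k) = 1 + 1 + 1 + 1 + 1 + 1" by simp
      then show ?thesis by (simp only: scale_left_distrib scale_one)
    qed
    show ?thesis
      by (simp add: D_star D_add star_commute scale_two six algebra_simps)
  qed
  have first: "D (c \<star> c) \<star> u - scale 2 (c \<star> (D c \<star> u)) = - scale 4 (D c \<star> D (D c))"
  proof -
    have "D (c \<star> c) \<star> u - scale 2 (c \<star> (D c \<star> u)) = - scale 2 (jassoc (\<cdot>) c (D c) u)"
      by (simp add: jassoc_def associator_def[of "star (\<cdot>)"] D_star star_bilinear star_commute
          scale_two algebra_simps)
    also have "\<dots> = - scale 4 (D c \<star> D (D c))"
      by (simp add: D u_def commutator_square_defect)
    finally show ?thesis .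
  qed
  have "glen scale (\<cdot>) a b c
      = scale (- 3) (D (c \<star> c) \<star> u - scale 2 (c \<star> (D c \<star> u)))
        - scale 2 (D (D (D (c \<star> c))) - scale 2 (c \<star> D (D (D c))))"
    by (simp add: glen_def shest star_bilinear scale_right_diff_distrib algebra_simps)
  also have "\<dots> = 0"
    unfolding first D3 by (simp add: scale_right_distrib)
  finally show ?thesis .
qed

end

lemma assosymmetric_plus_lie_triple:
  fixes scale :: "'k::field \<Rightarrow> 'a::ab_group_add \<Rightarrow> 'a" and mul
  assumes "assosymmetric_algebra scale mul" and "CHAR('k) \<noteq> 2"
  shows "lie_triple_algebra scale (star mul)" and "satisfies scale (star mul) glen_id"
proof -
  interpret assosymmetric_algebra_not_char_2 scale mul
    using assms
    by (simp add: assosymmetric_algebra_not_char_2_def assosymmetric_algebra_not_char_2_axioms_def)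
  interpret plus: nonassoc_algebra scale "star mul" by (rule nonassoc_algebra_star)
  have "lietriple (star mul) a b c = 0" for a b c
    using jassoc_derivation[of a b c]
    by (simp add: lietriple_def jassoc_def star_def[of "star mul"] star_commute scale_two)
  then show "lie_triple_algebra scale (star mul)"
    by (simp add: lie_triple_algebra_def nonassoc_algebra_star plus.satisfies_comm_id
        plus.satisfies_lietriple_id commutator_def star_commute)
  show "satisfies scale (star mul) glen_id"
    by (simp add: plus.satisfies_glen_id glen_star glen_eq_0)
qed


section \<open>Algebras given by structure constants\<close>

lemma not_consequenceI:
  fixes scale :: "'k::field \<Rightarrow> (nat \<Rightarrow>\<^sub>0 'k) \<Rightarrow> (nat \<Rightarrow>\<^sub>0 'k)"
  assumes "nonassoc_algebra scale mul" and "\<And>g. g \<in> G \<Longrightarrow> satisfies scale mul g"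
    and "\<not> satisfies scale mul f"
  shows "\<not> is_consequence f G"
  using assms unfolding is_consequence_def by blast

lemma is_consequence_mono: "is_consequence f G \<Longrightarrow> G \<subseteq> H \<Longrightarrow> is_consequence f H"
  unfolding is_consequence_def by blast

abbreviation coord ("_\<langle>_\<rangle>" [1000, 0] 1000) where
  "x\<langle>k\<rangle> \<equiv> Poly_Mapping.lookup x k"

abbreviation seq_scale :: "'k::field \<Rightarrow> (nat \<Rightarrow>\<^sub>0 'k) \<Rightarrow> (nat \<Rightarrow>\<^sub>0 'k)" where
  "seq_scale c \<equiv> Poly_Mapping.map ((*) c)"

lemma coord_simps:
  "(x + y)\<langle>k\<rangle> = x\<langle>k\<rangle> + y\<langle>k\<rangle>" "(x - y)\<langle>k\<rangle> = x\<langle>k\<rangle> - y\<langle>k\<rangle>" "(seq_scale c x)\<langle>k\<rangle> = c * x\<langle>k\<rangle>"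
  by (simp_all add: lookup_add lookup_minus Poly_Mapping.map.rep_eq when_def)

type_synonym 'k seq_form = "(nat \<Rightarrow>\<^sub>0 'k) \<Rightarrow> (nat \<Rightarrow>\<^sub>0 'k) \<Rightarrow> 'k"

definition bilinear_form :: "'k::field seq_form \<Rightarrow> bool" where
  "bilinear_form f \<longleftrightarrow> (\<forall>x y z c. f (x + y) z = f x z + f y z \<and> f z (x + y) = f z x + f z y \<and>
     f (seq_scale c x) z = c * f x z \<and> f z (seq_scale c x) = c * f z x)"

text \<open>
  Basis vectors beyond the length of the list have no coordinate in any product. If the forms do not
  involve them either, this is a finite-dimensional algebra plus a complement that annihilates
  everything. That puts the finite-dimensional algebra on the space of finitely supported sequences,
  over which \<open>is_consequence\<close> ranges.
\<close>

definition form_product :: "'k::field seq_form list \<Rightarrow> (nat \<Rightarrow>\<^sub>0 'k) \<Rightarrow> (nat \<Rightarrow>\<^sub>0 'k) \<Rightarrow> (nat \<Rightarrow>\<^sub>0 'k)"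
  where "form_product fs x y = Poly_Mapping.nth (map (\<lambda>f. f x y) fs)"

definition symmetrize :: "'k::field seq_form \<Rightarrow> 'k seq_form" where
  "symmetrize f x y = f x y + f y x"

lemma coord_form_product:
  "(form_product fs x y)\<langle>k\<rangle> = (if k < length fs then (fs ! k) x y else 0)"
  by (simp add: form_product_def nth_default_def)

lemma nonassoc_algebra_form_product:
  assumes "\<And>f. f \<in> set fs \<Longrightarrow> bilinear_form f"
  shows "nonassoc_algebra seq_scale (form_product fs)"
proof -
  interpret vector_space seq_scale
    by unfold_locales (rule poly_mapping_eqI, simp add: coord_simps algebra_simps)+
  have form: "bilinear_form (fs ! k)" if "k < length fs" for k
    using assms that by simp
  show ?thesis
  proof
    fix x y z :: "nat \<Rightarrow>\<^sub>0 'a" and c :: 'a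
    show "form_product fs x (y + z) = form_product fs x y + form_product fs x z"
      "form_product fs (x + y) z = form_product fs x z + form_product fs y z"
      "form_product fs x (seq_scale c y) = seq_scale c (form_product fs x y)"
      "form_product fs (seq_scale c x) y = seq_scale c (form_product fs x y)"
      by (rule poly_mapping_eqI,
          use form in \<open>simp add: coord_form_product coord_simps bilinear_form_def\<close>)+
  qed
qed

lemma form_product_symmetrize_commute:
  "form_product (map symmetrize fs) x y = form_product (map symmetrize fs) y x"
  by (rule poly_mapping_eqI) (simp add: coord_form_product symmetrize_def add.commute)


section \<open>Independence of commutativity\<close>

definition noncommutative_forms :: "'k::field seq_form list" where
  "noncommutative_forms = [\<lambda>x y. 0, \<lambda>x y. 0, \<lambda>x y. x\<langle>0\<rangle> * y\<langle>1\<rangle>]"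

text \<open>All products of three elements vanish, hence also \<open>lietriple\<close> and \<open>glen\<close>.\<close>

lemma comm_id_not_consequence:
  "\<not> is_consequence comm_id {lietriple_id, glen_id :: 'k::field free_alg}"
proof (rule not_consequenceI)
  let ?mul = "form_product noncommutative_forms :: (nat \<Rightarrow>\<^sub>0 'k) \<Rightarrow> _"
  show algebra: "nonassoc_algebra seq_scale ?mul"
    by (rule nonassoc_algebra_form_product)
      (auto simp: noncommutative_forms_def bilinear_form_def coord_simps algebra_simps)
  interpret nonassoc_algebra seq_scale ?mul by (rule algebra)
  have coord: "(?mul x y)\<langle>k\<rangle> = (if k = 2 then x\<langle>0\<rangle> * y\<langle>1\<rangle> else 0)" for x y k
    by (auto simp: coord_form_product noncommutative_forms_def less_Suc_eq numeral_eq_Suc)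
  have "lietriple ?mul a b c = 0" for a b c
    by (rule poly_mapping_eqI)
      (simp add: lietriple_def associator_def star_def coord coord_simps)
  moreover have "glen seq_scale ?mul a b c = 0" for a b c
    by (rule poly_mapping_eqI)
      (simp add: glen_def shest_def jassoc_def associator_def star_def coord coord_simps)
  ultimately show "satisfies seq_scale ?mul g" if "g \<in> {lietriple_id, glen_id}" for g
    using that by (auto simp: satisfies_lietriple_id satisfies_glen_id)
  have "(commutator ?mul (Poly_Mapping.single 0 1) (Poly_Mapping.single 1 1))\<langle>2\<rangle> \<noteq> 0"
    by (simp add: commutator_def coord coord_simps lookup_single)
  then show "\<not> satisfies seq_scale ?mul comm_id"
    unfolding satisfies_comm_id by (metis lookup_zero)
qed


section \<open>Independence of the Lie triple identity\<close>

definition nilpotent_forms :: "'k::field seq_form list" where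
  "nilpotent_forms = map symmetrize
     [\<lambda>x y. 0, \<lambda>x y. 0, \<lambda>x y. 0, \<lambda>x y. x\<langle>1\<rangle> * y\<langle>1\<rangle>, \<lambda>x y. x\<langle>2\<rangle> * y\<langle>3\<rangle>, \<lambda>x y. x\<langle>0\<rangle> * y\<langle>4\<rangle>]"

text \<open>
  The basis vectors 0, 1, 2 generate this algebra, with \<open>e\<^sub>0 ((e\<^sub>1 e\<^sub>1) e\<^sub>2)\<close> as the only nonzero
  product of four of them up to order. This monomial occurs only once in \<open>lietriple\<close>. All products
  of five elements vanish, and \<open>glen\<close> is homogeneous of degree eight.
\<close>

lemma lietriple_id_not_consequence:
  assumes "CHAR('k::field) \<noteq> 2"
  shows "\<not> is_consequence lietriple_id {comm_id, glen_id :: 'k free_alg}"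
proof (rule not_consequenceI)
  let ?mul = "form_product nilpotent_forms :: (nat \<Rightarrow>\<^sub>0 'k) \<Rightarrow> _"
  let ?e = "\<lambda>k. Poly_Mapping.single k 1 :: nat \<Rightarrow>\<^sub>0 'k"
  show algebra: "nonassoc_algebra seq_scale ?mul"
    by (rule nonassoc_algebra_form_product)
      (auto simp: nilpotent_forms_def symmetrize_def bilinear_form_def coord_simps algebra_simps)
  interpret nonassoc_algebra seq_scale ?mul by (rule algebra)
  have coord: "(?mul x y)\<langle>k\<rangle> = (if k = 3 then 2 * (x\<langle>1\<rangle> * y\<langle>1\<rangle>) else
      if k = 4 then x\<langle>2\<rangle> * y\<langle>3\<rangle> + y\<langle>2\<rangle> * x\<langle>3\<rangle> else
      if k = 5 then x\<langle>0\<rangle> * y\<langle>4\<rangle> + y\<langle>0\<rangle> * x\<langle>4\<rangle> else 0)" for x y k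
    by (auto simp: coord_form_product nilpotent_forms_def symmetrize_def less_Suc_eq numeral_eq_Suc)
  have "commutator ?mul a b = 0" for a b
    unfolding commutator_def nilpotent_forms_def
    by (subst form_product_symmetrize_commute) simp
  moreover have "glen seq_scale ?mul a b c = 0" for a b c
    by (rule poly_mapping_eqI)
      (simp add: glen_def shest_def jassoc_def associator_def star_def coord coord_simps)
  ultimately show "satisfies seq_scale ?mul g" if "g \<in> {comm_id, glen_id}" for g
    using that by (auto simp: satisfies_comm_id satisfies_glen_id)
  have "(lietriple ?mul (?e 0) (?e 1) (?e 2))\<langle>5\<rangle> \<noteq> 0"
    using of_nat_prime_neq_0[of 2] assms
    by (simp add: lietriple_def associator_def star_def coord coord_simps lookup_single)
  then show "\<not> satisfies seq_scale ?mul lietriple_id"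
    unfolding satisfies_lietriple_id by (metis lookup_zero)
qed


section \<open>Independence of the Glennie identity\<close>

definition det2 :: "nat \<Rightarrow> nat \<Rightarrow> 'k::field seq_form" where
  "det2 i j x y = x\<langle>i\<rangle> * y\<langle>j + 1\<rangle> - x\<langle>i + 1\<rangle> * y\<langle>j\<rangle>"

text \<open>
  The algebra is \<open>M\<^sub>2(K) \<oplus> (U\<^sub>p \<oplus> U\<^sub>q \<oplus> U\<^sub>r) \<oplus> (K t\<^sub>p\<^sub>q \<oplus> K t\<^sub>p\<^sub>r \<oplus> K t\<^sub>q\<^sub>r) \<oplus> W\<close> with
  two-dimensional \<open>U\<^sub>p, U\<^sub>q, U\<^sub>r, W\<close>, and the coordinates 0 to 14 are in this order. The four summands
  are attached to the exterior powers of degrees 0 to 3 of a space with basis \<open>p, q, r\<close>, and products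
  respect this grading. A matrix \<open>S\<close> acts on each \<open>U\<close> by \<open>S\<close>, on the \<open>t\<close> by its trace and on \<open>W\<close>
  by its adjugate; two vectors from different \<open>U\<close> multiply by their determinant, and the last two
  forms expand \<open>t\<^sub>p\<^sub>q r - t\<^sub>p\<^sub>r q + t\<^sub>q\<^sub>r p\<close>.

  Up to the choice of basis this is the span of \<open>e\<^sub>2\<close>, \<open>e\<^sub>3\<close> and thirteen off-diagonal basis elements
  in the algebra of Hermitian 3 by 3 matrices over the split octonions, with product \<open>x y + y x\<close>.
  The two idempotents and a hyperbolic pair in one off-diagonal position form \<open>M\<^sub>2(K)\<close>.
\<close>

definition exceptional_forms :: "'k::field seq_form list" where
  "exceptional_forms = map symmetrize
     [\<lambda>x y. x\<langle>0\<rangle> * y\<langle>0\<rangle> + x\<langle>1\<rangle> * y\<langle>2\<rangle>, \<lambda>x y. x\<langle>0\<rangle> * y\<langle>1\<rangle> + x\<langle>1\<rangle> * y\<langle>3\<rangle>,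
      \<lambda>x y. x\<langle>2\<rangle> * y\<langle>0\<rangle> + x\<langle>3\<rangle> * y\<langle>2\<rangle>, \<lambda>x y. x\<langle>2\<rangle> * y\<langle>1\<rangle> + x\<langle>3\<rangle> * y\<langle>3\<rangle>,
      \<lambda>x y. x\<langle>0\<rangle> * y\<langle>4\<rangle> + x\<langle>1\<rangle> * y\<langle>5\<rangle>, \<lambda>x y. x\<langle>2\<rangle> * y\<langle>4\<rangle> + x\<langle>3\<rangle> * y\<langle>5\<rangle>,
      \<lambda>x y. x\<langle>0\<rangle> * y\<langle>6\<rangle> + x\<langle>1\<rangle> * y\<langle>7\<rangle>, \<lambda>x y. x\<langle>2\<rangle> * y\<langle>6\<rangle> + x\<langle>3\<rangle> * y\<langle>7\<rangle>,
      \<lambda>x y. x\<langle>0\<rangle> * y\<langle>8\<rangle> + x\<langle>1\<rangle> * y\<langle>9\<rangle>, \<lambda>x y. x\<langle>2\<rangle> * y\<langle>8\<rangle> + x\<langle>3\<rangle> * y\<langle>9\<rangle>,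
      \<lambda>x y. (x\<langle>0\<rangle> + x\<langle>3\<rangle>) * y\<langle>10\<rangle> + det2 4 6 x y,
      \<lambda>x y. (x\<langle>0\<rangle> + x\<langle>3\<rangle>) * y\<langle>11\<rangle> + det2 4 8 x y,
      \<lambda>x y. (x\<langle>0\<rangle> + x\<langle>3\<rangle>) * y\<langle>12\<rangle> + det2 6 8 x y,
      \<lambda>x y. x\<langle>3\<rangle> * y\<langle>13\<rangle> - x\<langle>1\<rangle> * y\<langle>14\<rangle> + x\<langle>10\<rangle> * y\<langle>8\<rangle> - x\<langle>11\<rangle> * y\<langle>6\<rangle> + x\<langle>12\<rangle> * y\<langle>4\<rangle>,
      \<lambda>x y. x\<langle>0\<rangle> * y\<langle>14\<rangle> - x\<langle>2\<rangle> * y\<langle>13\<rangle> + x\<langle>10\<rangle> * y\<langle>9\<rangle> - x\<langle>11\<rangle> * y\<langle>7\<rangle> + x\<langle>12\<rangle> * y\<langle>5\<rangle>]"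

definition exceptional_mul :: "(nat \<Rightarrow>\<^sub>0 'k::field) \<Rightarrow> (nat \<Rightarrow>\<^sub>0 'k) \<Rightarrow> (nat \<Rightarrow>\<^sub>0 'k)" where
  "exceptional_mul = form_product exceptional_forms"

lemma nonassoc_algebra_exceptional: "nonassoc_algebra seq_scale exceptional_mul"
  unfolding exceptional_mul_def
  by (rule nonassoc_algebra_form_product)
    (auto simp: exceptional_forms_def symmetrize_def det2_def bilinear_form_def coord_simps
      algebra_simps)

lemma exceptional_mul_commute: "exceptional_mul x y = exceptional_mul y x"
  unfolding exceptional_mul_def exceptional_forms_def by (rule form_product_symmetrize_commute)

lemma exceptional_coord:
  "(exceptional_mul x y)\<langle>k\<rangle> = (if k < 15 then (exceptional_forms ! k) x y else 0)"
  by (simp add: exceptional_mul_def coord_form_product exceptional_forms_def)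

lemmas exceptional_coords =
  exceptional_coord[where k = "0", simplified exceptional_forms_def det2_def, simplified]
  exceptional_coord[where k = "Suc 0", simplified exceptional_forms_def det2_def, simplified]
  exceptional_coord[where k = "2", simplified exceptional_forms_def det2_def, simplified]
  exceptional_coord[where k = "3", simplified exceptional_forms_def det2_def, simplified]
  exceptional_coord[where k = "4", simplified exceptional_forms_def det2_def, simplified]
  exceptional_coord[where k = "5", simplified exceptional_forms_def det2_def, simplified]
  exceptional_coord[where k = "6", simplified exceptional_forms_def det2_def, simplified]
  exceptional_coord[where k = "7", simplified exceptional_forms_def det2_def, simplified]
  exceptional_coord[where k = "8", simplified exceptional_forms_def det2_def, simplified]
  exceptional_coord[where k = "9", simplified exceptional_forms_def det2_def, simplified]
  exceptional_coord[where k = "10", simplified exceptional_forms_def det2_def, simplified]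
  exceptional_coord[where k = "11", simplified exceptional_forms_def det2_def, simplified]
  exceptional_coord[where k = "12", simplified exceptional_forms_def det2_def, simplified]
  exceptional_coord[where k = "13", simplified exceptional_forms_def det2_def, simplified]
  exceptional_coord[where k = "14", simplified exceptional_forms_def det2_def, simplified]

text \<open>
  All Jordan algebras satisfy the Lie triple identity. Here it is verified directly: each
  coordinate is a polynomial identity of degree four in the coordinates of the arguments.
\<close>

lemma exceptional_lietriple: "lietriple exceptional_mul a b c = 0"
proof (rule poly_mapping_eqI)
  fix k :: nat
  let ?P = "\<lambda>k. (lietriple exceptional_mul a b c)\<langle>k\<rangle> = 0"
  have "?P 0" "?P (Suc 0)" "?P 2" "?P 3" "?P 4" "?P 5" "?P 6" "?P 7"
    "?P 8" "?P 9" "?P 10" "?P 11" "?P 12" "?P 13" "?P 14"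
    by (simp only: lietriple_def associator_def star_def coord_simps exceptional_coords
          symmetrize_def, algebra)+
  moreover have "k < 15 \<longleftrightarrow> k \<in> {0, Suc 0, 2, 3, 4, 5, 6, 7, 8, 9, 10, 11, 12, 13, 14}"
    by (simp add: numeral_eq_Suc less_Suc_eq)
  ultimately have "?P k" if "k < 15"
    using that by blast
  moreover have "?P k" if "\<not> k < 15"
    using that by (simp add: lietriple_def associator_def star_def coord_simps exceptional_coord)
  ultimately show "(lietriple exceptional_mul a b c)\<langle>k\<rangle> = 0\<langle>k\<rangle>"
    by auto
qed

lemma nth_arith:
  "length xs = length ys \<Longrightarrow> Poly_Mapping.nth xs + Poly_Mapping.nth ys = Poly_Mapping.nth (map2 (+) xs ys)"
  "length xs = length ys \<Longrightarrow> Poly_Mapping.nth xs - Poly_Mapping.nth ys = Poly_Mapping.nth (map2 (-) xs ys)"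
  "seq_scale c (Poly_Mapping.nth xs) = Poly_Mapping.nth (map ((*) c) xs)"
  by (rule poly_mapping_eqI, simp add: coord_simps nth_default_def)+

text \<open>
  With matrix units \<open>E\<^sub>i\<^sub>j\<close>, the arguments are \<open>E\<^sub>1\<^sub>2 + p\<^sub>2\<close>, \<open>- E\<^sub>1\<^sub>1 + q\<^sub>2\<close> and \<open>E\<^sub>2\<^sub>1 + r\<^sub>1\<close>. The
  vectors \<open>p\<^sub>2, q\<^sub>2, r\<^sub>1\<close> supply the exterior degree 3 of \<open>W\<close>. Since \<open>6144 = 2\<^sup>1\<^sup>1 \<cdot> 3\<close>, the value
  is zero in the characteristics 2 and 3 only.
\<close>

lemma exceptional_glen:
  "glen seq_scale exceptional_mul
     (Poly_Mapping.nth [0, 1, 0, 0, 0, 1, 0, 0, 0, 0, 0, 0, 0, 0, 0])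
     (Poly_Mapping.nth [- 1, 0, 0, 0, 0, 0, 0, 1, 0, 0, 0, 0, 0, 0, 0])
     (Poly_Mapping.nth [0, 0, 1, 0, 0, 0, 0, 0, 1, 0, 0, 0, 0, 0, 0])
   = Poly_Mapping.nth [0, 0, 0, 0, 0, 0, 0, 0, 0, 0, 0, 0, 0, 6144, 0]"
  by (simp add: glen_def shest_def jassoc_def associator_def star_def form_product_def
      exceptional_mul_def exceptional_forms_def symmetrize_def det2_def nth_default_def nth_arith)

lemma glen_id_not_consequence:
  assumes "CHAR('k::field) \<noteq> 2" and "CHAR('k) \<noteq> 3"
  shows "\<not> is_consequence glen_id {comm_id, lietriple_id :: 'k free_alg}"
proof (rule not_consequenceI)
  interpret nonassoc_algebra seq_scale "exceptional_mul :: (nat \<Rightarrow>\<^sub>0 'k) \<Rightarrow> _"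
    by (rule nonassoc_algebra_exceptional)
  show "nonassoc_algebra seq_scale (exceptional_mul :: (nat \<Rightarrow>\<^sub>0 'k) \<Rightarrow> _)"
    by (rule nonassoc_algebra_exceptional)
  show "satisfies seq_scale exceptional_mul g" if "g \<in> {comm_id, lietriple_id :: 'k free_alg}" for g
    using that exceptional_mul_commute exceptional_lietriple
    by (auto simp: satisfies_comm_id satisfies_lietriple_id commutator_def)
  have "(2::'k) \<noteq> 0" "(3::'k) \<noteq> 0"
    using of_nat_prime_neq_0[of 2] of_nat_prime_neq_0[of 3] assms by simp_all
  moreover have "(6144::'k) = 2 ^ 11 * 3" by simp
  ultimately have "(6144::'k) \<noteq> 0" by (metis mult_eq_0_iff power_not_zero)
  then have "(Poly_Mapping.nth [0, 0, 0, 0, 0, 0, 0, 0, 0, 0, 0, 0, 0, 6144, 0 :: 'k])\<langle>13\<rangle> \<noteq> 0"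
    by (simp add: nth_default_def)
  then show "\<not> satisfies seq_scale exceptional_mul (glen_id :: 'k free_alg)"
    unfolding satisfies_glen_id exceptional_glen[symmetric] by (metis lookup_zero)
qed


section \<open>Identities of the plus-algebras and their independence\<close>

theorem theorem0p1:
  assumes "CHAR('k::field) \<noteq> 2"
  shows
    "(\<forall>(scale :: 'k \<Rightarrow> 'a::ab_group_add \<Rightarrow> 'a) mul. assosymmetric_algebra scale mul \<longrightarrow>
        lie_triple_algebra scale (star mul) \<and>
        (\<forall>a b c. jassoc mul a (star mul b b) c = scale 2 (star mul b (jassoc mul a b c)))) \<and>
     (\<forall>(scale :: 'k \<Rightarrow> 'a \<Rightarrow> 'a) mul. assosymmetric_algebra scale mul \<longrightarrow>
        satisfies scale (star mul) glen_id \<and>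
        (\<forall>a b c. shest scale mul a b (star mul c c)
           - scale 2 (star mul c (shest scale mul a b c)) = 0)) \<and>
     (CHAR('k) \<noteq> 3 \<longrightarrow>
        independent_identities {comm_id, lietriple_id, glen_id :: 'k free_alg}) \<and>
     \<not> is_consequence comm_id {lietriple_id, glen_id :: 'k free_alg} \<and>
     \<not> is_consequence lietriple_id {comm_id, glen_id :: 'k free_alg}"
proof (intro conjI allI impI)
  fix scale :: "'k \<Rightarrow> 'a \<Rightarrow> 'a" and mul
  assume algebra: "assosymmetric_algebra scale mul"
  then interpret assosymmetric_algebra_not_char_2 scale mul
    using assms
    by (simp add: assosymmetric_algebra_not_char_2_def assosymmetric_algebra_not_char_2_axioms_def)
  show "lie_triple_algebra scale (star mul)" "satisfies scale (star mul) glen_id"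
    using assosymmetric_plus_lie_triple[OF algebra assms] by simp_all
  fix a b c
  show "jassoc mul a (star mul b b) c = scale 2 (star mul b (jassoc mul a b c))"
    by (rule jassoc_derivation)
  show "shest scale mul a b (star mul c c) - scale 2 (star mul c (shest scale mul a b c)) = 0"
    using glen_eq_0[of a b c] by (simp add: glen_def)
next
  assume "CHAR('k) \<noteq> 3"
  show "independent_identities {comm_id, lietriple_id, glen_id :: 'k free_alg}"
    unfolding independent_identities_def
  proof
    fix f :: "'k free_alg"
    let ?G = "{comm_id, lietriple_id, glen_id :: 'k free_alg}"
    assume "f \<in> ?G"
    then consider "f = comm_id" | "f = lietriple_id" | "f = glen_id" by blast
    then show "\<not> is_consequence f (?G - {f})"
    proof cases
      case 1
      then show ?thesis
        using comm_id_not_consequence[where 'k = 'k]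
          is_consequence_mono[of f "?G - {f}" "{lietriple_id, glen_id}"] by auto
    next
      case 2
      then show ?thesis
        using lietriple_id_not_consequence[OF assms]
          is_consequence_mono[of f "?G - {f}" "{comm_id, glen_id}"] by auto
    next
      case 3
      then show ?thesis
        using glen_id_not_consequence[OF assms \<open>CHAR('k) \<noteq> 3\<close>]
          is_consequence_mono[of f "?G - {f}" "{comm_id, lietriple_id}"] by auto
    qed
  qed
qed (use assms comm_id_not_consequence lietriple_id_not_consequence in blast)+

end
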